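(* Let $q$ be a prime power, let $n$ be a positive integer with $\gcd(n,q)=1$, and let $\lambda_1,\lambda_2\in\mathbb{F}_q^*$. For $i=1,2$ let $\mathcal{C}_i=\langle g_i(x)\rangle\subseteq\mathbb{F}_q^n$ be a $\lambda_i$-constacyclic code of length $n$ with generator polynomial $g_i(x)$. Let $s(x)\in\mathbb{F}_q[x]$ be a polynomial such that $\gcd\left(s(x),\,(x^n-\lambda_1)/g_1(x)\right)=1$, let $g(x)=g_1(x)s(x)$ (viewed as an element of $\mathbb{F}_q[x]/\langle x^n-\lambda_1\rangle$, i.e. as a vector of $\mathbb{F}_q^n$), and let $$P=\{\,g\circ x^jg_2 : 0\le j<n-\deg(g_2)\,\}.$$ Then the $\lambda_1\lambda_2$-constacyclic code $\mathcal{C}_1\circ\mathcal{C}_2$ is generated by the polynomial $\gcd(P,\ x^n-\lambda_1\lambda_2)$, i.e. the greatest common divisor of all the polynomials in $P$ together with $x^n-\lambda_1\lambda_2$.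
   Context: Vectors $(a_0,\ldots,a_{n-1})\in\mathbb{F}_q^n$ are identified with polynomials $\sum_{i=0}^{n-1}a_ix^i$ of degree less than $n$; an element of $\mathbb{F}_q[x]/\langle x^n-\lambda\rangle$ is identified with its representative of degree less than $n$. For $\lambda\in\mathbb{F}_q^*$, a $\lambda$-constacyclic code of length $n$ is (under this identification) an ideal of $\mathbb{F}_q[x]/\langle x^n-\lambda\rangle$; it is generated by a unique monic polynomial dividing $x^n-\lambda$, called its generator polynomial. The Schur product $\circ$ of vectors (equivalently, of polynomials of degree less than $n$) is the component-wise (coefficient-wise) product, and for codes $\mathcal{C}_1\circ\mathcal{C}_2=\operatorname{span}_{\mathbb{F}_q}\{\mathbf{c}_1\circ\mathbf{c}_2:\mathbf{c}_1\in\mathcal{C}_1,\mathbf{c}_2\in\mathcal{C}_2\}$. The Schur product of a $\lambda_1$-constacyclic code and a $\lambda_2$-constacyclic code is $\lambda_1\lambda_2$-constacyclic. *)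

theory Defs
  imports
    "HOL-Computational_Algebra.Polynomial_Factorial"
    "HOL-Algebra.Ideal"
begin

text \<open>
  A vector of length \<open>n\<close> is represented by the polynomial of degree less than \<open>n\<close> with the same
  coefficients, and a residue class modulo \<open>x ^ n - lam\<close> by its representative of degree less
  than \<open>n\<close>. The class \<^class>\<open>field_gcd\<close> is no restriction on the field: its normalisation and
  gcd operations are determined by the field structure, and they make the gcd of polynomials monic
  (see \<open>lead_coeff_Gcd\<close> below).
\<close>

definition constacyclic_modulus :: "nat \<Rightarrow> 'a \<Rightarrow> 'a::field poly" where
  "constacyclic_modulus n lam = monom 1 n - [:lam:]"

definition constacyclic_ring :: "nat \<Rightarrow> 'a \<Rightarrow> 'a::field poly ring" where
  "constacyclic_ring n lam =
     \<lparr>carrier = {p. degree p < n},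
      mult = (\<lambda>p r. (p * r) mod constacyclic_modulus n lam),
      one = 1, zero = 0, add = (+)\<rparr>"

definition constacyclic_code :: "nat \<Rightarrow> 'a \<Rightarrow> 'a::field poly set \<Rightarrow> bool" where
  "constacyclic_code n lam C \<longleftrightarrow> ideal C (constacyclic_ring n lam)"

text \<open>
  The generator is reduced first: the generator polynomial of the zero code is \<open>x ^ n - lam\<close>
  itself, which is not a representative.
\<close>

definition code_generated_by :: "nat \<Rightarrow> 'a \<Rightarrow> 'a::field poly \<Rightarrow> 'a poly set" where
  "code_generated_by n lam g = PIdl\<^bsub>constacyclic_ring n lam\<^esub> (g mod constacyclic_modulus n lam)"

definition generator_polynomial :: "nat \<Rightarrow> 'a \<Rightarrow> 'a::field poly set \<Rightarrow> 'a poly \<Rightarrow> bool" where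
  "generator_polynomial n lam C g \<longleftrightarrow>
     lead_coeff g = 1 \<and> g dvd constacyclic_modulus n lam \<and> C = code_generated_by n lam g"

lift_definition schur :: "'a::field poly \<Rightarrow> 'a poly \<Rightarrow> 'a poly"  (infixl "\<circ>\<^sub>S" 70)
  is "\<lambda>a b i. a i * b i"
  by (auto elim: eventually_mono)

lemma coeff_schur [simp]: "coeff (p \<circ>\<^sub>S r) i = coeff p i * coeff r i"
  by transfer simp

definition schur_code :: "'a::field poly set \<Rightarrow> 'a poly set \<Rightarrow> 'a poly set" where
  "schur_code C D = module.span smult {c \<circ>\<^sub>S d | c d. c \<in> C \<and> d \<in> D}"

lemma lead_coeff_Gcd:
  fixes A :: "'a::field_gcd poly set"
  assumes "Gcd A \<noteq> 0"
  shows "lead_coeff (Gcd A) = 1"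
proof -
  have "normalize (Gcd A) = Gcd A" by simp
  hence "unit_factor (Gcd A) = 1"
    using assms by (metis unit_factor_normalize)
  hence "[:unit_factor (lead_coeff (Gcd A)):] = 1"
    by (simp add: unit_factor_poly_def monom_0)
  moreover have "unit_factor (lead_coeff (Gcd A)) = lead_coeff (Gcd A)"
    using assms by (intro is_unit_unit_factor) (simp add: dvd_field_iff)
  ultimately show ?thesis by (simp add: one_pCons)
qed

lemma degree_constacyclic_modulus:
  assumes "n > 0"
  shows "degree (constacyclic_modulus n lam) = n"
  using assms unfolding constacyclic_modulus_def
  by (subst diff_conv_add_uminus, subst degree_add_eq_left) (auto simp: degree_monom_eq)

lemma mod_constacyclic_modulus_eq:
  assumes "degree p < n"
  shows "p mod constacyclic_modulus n lam = p"
  using assms degree_constacyclic_modulus[of n lam] by (simp add: mod_poly_less)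

lemma degree_mod_constacyclic_modulus:
  assumes "n > 0"
  shows "degree (p mod constacyclic_modulus n lam) < n"
proof -
  have "constacyclic_modulus n lam \<noteq> 0"
    using degree_constacyclic_modulus[OF assms, of lam] assms by force
  thus ?thesis
    using degree_mod_less[of "constacyclic_modulus n lam" p]
      degree_constacyclic_modulus[OF assms, of lam] assms by auto
qed

lemma cring_constacyclic_ring:
  assumes "n > 0"
  shows "cring (constacyclic_ring n lam)"
proof (rule cringI)
  show "abelian_group (constacyclic_ring n lam)"
  proof (rule abelian_groupI)
    fix p assume "p \<in> carrier (constacyclic_ring n lam)"
    thus "\<exists>r\<in>carrier (constacyclic_ring n lam).
        r \<oplus>\<^bsub>constacyclic_ring n lam\<^esub> p = \<zero>\<^bsub>constacyclic_ring n lam\<^esub>"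
      by (intro bexI[of _ "- p"]) (auto simp: constacyclic_ring_def)
  qed (use assms in \<open>auto simp: constacyclic_ring_def degree_add_less algebra_simps\<close>)
  show "Group.comm_monoid (constacyclic_ring n lam)"
    by (rule comm_monoidI)
       (use assms in \<open>auto simp: constacyclic_ring_def degree_mod_constacyclic_modulus
          mod_constacyclic_modulus_eq mod_mult_left_eq mod_mult_right_eq mult_ac\<close>)
qed (auto simp: constacyclic_ring_def poly_mod_add_left distrib_right)

end

theory Submission
  imports Defs
begin

text \<open>
  Multiplication by \<open>x\<close> acts on representatives modulo \<open>x ^ n - lam\<close> as a weighted cyclic shift,
  and the Schur product of a shift with weight \<open>lam1\<close> and one with weight \<open>lam2\<close> is the shift with
  weight \<open>lam1 * lam2\<close> of the Schur product. Hence \<open>C1 \<circ> C2\<close> is an ideal. It contains \<open>P\<close>, so by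
  Bezout also the multiples of the gcd. Conversely \<open>C1\<close> is spanned by the shifts of \<open>g\<close>, and as
  \<open>x\<close> is a unit modulo \<open>x ^ n - lam2\<close>, every \<open>d \<in> C2\<close> is the \<open>i\<close>-th shift of some \<open>d' \<in> C2\<close>;
  thus the product of the \<open>i\<close>-th shift of \<open>g\<close> with \<open>d\<close> is the \<open>i\<close>-th shift of \<open>g \<circ> d'\<close>,
  where \<open>d'\<close> is a combination of the polynomials \<open>x ^ j * g2\<close> with \<open>j < n - deg g2\<close>.
\<close>

section \<open>Schur products and weighted cyclic shifts\<close>

interpretation poly_vs: vector_space "smult :: 'a::field \<Rightarrow> 'a poly \<Rightarrow> 'a poly"
  by standard (auto simp: smult_add_right smult_add_left)

lemma degree_schur_less:
  assumes "degree a < n"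
  shows "degree (a \<circ>\<^sub>S b) < n"
proof -
  have "degree (a \<circ>\<^sub>S b) \<le> degree a"
    by (rule degree_le) (simp add: coeff_eq_0)
  with assms show ?thesis by simp
qed

lemma schur_add_left: "(a + b) \<circ>\<^sub>S c = a \<circ>\<^sub>S c + b \<circ>\<^sub>S c"
  and schur_add_right: "c \<circ>\<^sub>S (a + b) = c \<circ>\<^sub>S a + c \<circ>\<^sub>S b"
  and schur_smult_left: "smult k a \<circ>\<^sub>S c = smult k (a \<circ>\<^sub>S c)"
  and schur_smult_right: "c \<circ>\<^sub>S smult k a = smult k (c \<circ>\<^sub>S a)"
  and schur_0_left: "0 \<circ>\<^sub>S c = 0"
  and schur_0_right: "c \<circ>\<^sub>S 0 = 0"
  by (auto simp: poly_eq_iff algebra_simps)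

lemma coeff_shift:
  assumes "n > 0" "degree p < n"
  shows "coeff ((monom 1 1 * p) mod constacyclic_modulus n lam) i =
    (if i = 0 then lam * coeff p (n - 1) else if i < n then coeff p (i - 1) else 0)"
proof -
  let ?m = "constacyclic_modulus n lam"
  \<comment> \<open>The only term of \<open>monom 1 1 * p\<close> that can reach degree
    \<open>n\<close> has coefficient \<open>coeff p (n - 1)\<close>. Subtracting this multiple of
    the modulus cancels it and leaves \<open>lam * coeff p (n - 1)\<close> in degree 0.\<close>
  define r where "r = monom 1 1 * p - smult (coeff p (n - 1)) ?m"
  have coeff_r: "coeff r i =
    (if i = 0 then lam * coeff p (n - 1) else if i < n then coeff p (i - 1) else 0)" for i
    using assms unfolding r_def constacyclic_modulus_def
    by (cases "i = n") (auto simp: coeff_monom_mult coeff_eq_0 coeff_pCons split: nat.splits)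
  have "degree r \<le> n - 1"
    by (rule degree_le) (use coeff_r assms in auto)
  hence "degree r < n" using assms(1) by linarith
  hence "r mod ?m = r" by (rule mod_constacyclic_modulus_eq)
  moreover have "r mod ?m = (monom 1 1 * p) mod ?m"
    by (simp add: r_def mod_eq_dvd_iff dvd_smult)
  ultimately show ?thesis using coeff_r by metis
qed

lemma schur_shift:
  assumes "n > 0" "degree a < n" "degree b < n"
  shows "((monom 1 1 * a) mod constacyclic_modulus n lam1) \<circ>\<^sub>S
      ((monom 1 1 * b) mod constacyclic_modulus n lam2) =
    (monom 1 1 * (a \<circ>\<^sub>S b)) mod constacyclic_modulus n (lam1 * lam2)"
  using assms by (auto simp: poly_eq_iff coeff_shift degree_schur_less simp del: One_nat_def)

lemma schur_shift_iterated:
  assumes "n > 0" "degree a < n" "degree b < n"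
  shows "((monom 1 i * a) mod constacyclic_modulus n lam1) \<circ>\<^sub>S
      ((monom 1 i * b) mod constacyclic_modulus n lam2) =
    (monom 1 i * (a \<circ>\<^sub>S b)) mod constacyclic_modulus n (lam1 * lam2)"
proof (induction i)
  case 0
  show ?case
    using assms by (simp add: monom_0 mod_constacyclic_modulus_eq degree_schur_less flip: one_pCons)
next
  case (Suc i)
  have step: "(monom 1 (Suc i) * c) mod constacyclic_modulus n l =
      (monom 1 1 * ((monom 1 i * c) mod constacyclic_modulus n l)) mod constacyclic_modulus n l"
    for c :: "'a poly" and l
    by (simp add: mod_mult_right_eq mult_monom flip: mult.assoc)
  show ?case
    unfolding step
    by (subst schur_shift) (use assms Suc in \<open>auto simp: degree_mod_constacyclic_modulus\<close>)
qed

section \<open>Multiples of a generator, constacyclic codes and polynomial ideals\<close>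

lemma poly_mod_sum:
  fixes f :: "'b \<Rightarrow> 'a::field poly"
  shows "sum f A mod m = (\<Sum>i\<in>A. f i mod m)"
  by (induction A rule: infinite_finite_induct) (auto simp: poly_mod_add_left)

text \<open>Reduction modulo \<open>m\<close> is linear, so only the monomials of \<open>u\<close>
  matter. Since \<open>m\<close> is arbitrary, \<open>m = 0\<close> covers unreduced products; there
  the bound \<open>i \<le> degree u\<close> keeps the shifts of \<open>h\<close> short.\<close>

lemma mult_mod_in_subspace:
  fixes u h m :: "'a::field poly"
  assumes V: "poly_vs.subspace V"
    and "\<And>i. i \<le> degree u \<Longrightarrow> (monom 1 i * h) mod m \<in> V"
  shows "(u * h) mod m \<in> V"
proof -
  have "u * h = (\<Sum>i\<le>degree u. smult (coeff u i) (monom 1 i * h))"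
    by (subst poly_as_sum_of_monoms[of u, symmetric])
       (simp add: sum_distrib_right smult_monom flip: mult_smult_left)
  hence "(u * h) mod m = (\<Sum>i\<le>degree u. smult (coeff u i) ((monom 1 i * h) mod m))"
    by (simp add: poly_mod_sum mod_smult_left)
  also have "\<dots> \<in> V"
    by (intro poly_vs.subspace_sum poly_vs.subspace_scale V) (use assms(2) in auto)
  finally show ?thesis .
qed

lemma code_generated_by_eq_multiples:
  assumes "n > 0"
  shows "code_generated_by n lam h = range (\<lambda>u. (u * h) mod constacyclic_modulus n lam)"
proof -
  let ?m = "constacyclic_modulus n lam"
  have "\<exists>x. degree x < n \<and> (u * h) mod ?m = (x * (h mod ?m)) mod ?m" for u
    by (rule exI[of _ "u mod ?m"])
       (simp add: assms degree_mod_constacyclic_modulus mod_mult_eq)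
  thus ?thesis
    by (auto simp: code_generated_by_def cgenideal_def constacyclic_ring_def mod_mult_right_eq)
qed

text \<open>By Bezout, \<open>h\<close> and its gcd with the modulus generate the same ideal. This
  covers generators that do not divide the modulus.\<close>

lemma code_generated_by_eq_dvd:
  fixes h :: "'a::field_gcd poly"
  assumes "n > 0"
  shows "code_generated_by n lam h =
    {p. degree p < n \<and> gcd h (constacyclic_modulus n lam) dvd p}"
proof (intro equalityI subsetI)
  let ?m = "constacyclic_modulus n lam"
  fix p assume "p \<in> code_generated_by n lam h"
  then obtain u where "p = (u * h) mod ?m"
    using code_generated_by_eq_multiples[OF assms, of lam h] by auto
  thus "p \<in> {p. degree p < n \<and> gcd h ?m dvd p}"
    by (simp add: assms degree_mod_constacyclic_modulus dvd_mod)
next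
  let ?m = "constacyclic_modulus n lam"
  fix p assume "p \<in> {p. degree p < n \<and> gcd h ?m dvd p}"
  then obtain v where p: "degree p < n" "p = gcd h ?m * v" by (auto elim: dvdE)
  obtain a b where "a * h + b * ?m = gcd h ?m"
    using bezout_coefficients_fst_snd by blast
  hence "p = (v * a) * h + (v * b) * ?m"
    using p(2) by (metis distrib_left mult.assoc mult.commute)
  hence "p mod ?m = ((v * a) * h) mod ?m" by simp
  hence "p = ((v * a) * h) mod ?m"
    using mod_constacyclic_modulus_eq[OF p(1)] by simp
  thus "p \<in> code_generated_by n lam h"
    unfolding code_generated_by_eq_multiples[OF assms] by blast
qed

lemma constacyclic_code_generated_by:
  assumes "n > 0"
  shows "constacyclic_code n lam (code_generated_by n lam h)"
  unfolding constacyclic_code_def code_generated_by_def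
  by (intro cring.cgenideal_ideal cring_constacyclic_ring assms)
     (simp add: constacyclic_ring_def degree_mod_constacyclic_modulus assms)

text \<open>Writing the modulus as \<open>h * k\<close>, the gcd of \<open>h * s\<close> and
  \<open>h * k\<close> is that of \<open>s\<close> and \<open>k\<close> times \<open>h\<close>, so
  coprimality leaves just \<open>h\<close> up to normalisation; a code depends only on this
  gcd.\<close>

lemma code_generated_by_mult_coprime:
  fixes h s :: "'a::field_gcd poly"
  assumes "n > 0" "h dvd constacyclic_modulus n lam"
    and "gcd s (constacyclic_modulus n lam div h) = 1"
  shows "code_generated_by n lam ((h * s) mod constacyclic_modulus n lam) =
    code_generated_by n lam h"
proof -
  let ?m = "constacyclic_modulus n lam"
  obtain k where k: "?m = h * k" using assms(2) by (auto elim: dvdE)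
  have "?m \<noteq> 0" using degree_constacyclic_modulus[OF assms(1), of lam] assms(1) by auto
  hence "h \<noteq> 0" using k by auto
  hence "gcd s k = 1" using assms(3) k by simp
  hence "gcd (h * s) ?m = gcd h ?m"
    unfolding k by (simp add: gcd_mult_left gcd_proj1_if_dvd)
  moreover have "gcd ((h * s) mod ?m) ?m = gcd (h * s) ?m"
    by (subst (1 2) gcd.commute, rule gcd_mod_right) (fact \<open>?m \<noteq> 0\<close>)
  ultimately show ?thesis
    by (simp add: code_generated_by_eq_dvd assms(1))
qed

lemma mult_mod_in_code_generated_by:
  assumes "n > 0" "c \<in> code_generated_by n lam h"
  shows "(u * c) mod constacyclic_modulus n lam \<in> code_generated_by n lam h"
proof -
  obtain v where "c = (v * h) mod constacyclic_modulus n lam"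
    using assms code_generated_by_eq_multiples by blast
  hence "(u * c) mod constacyclic_modulus n lam = ((u * v) * h) mod constacyclic_modulus n lam"
    by (simp add: mod_mult_right_eq mult.assoc)
  thus ?thesis unfolding code_generated_by_eq_multiples[OF assms(1)] by blast
qed

text \<open>When \<open>h\<close> divides the modulus, every codeword is an honest multiple
  \<open>u * h\<close> of degree below \<open>n\<close>. No wrap-around occurs, so the shifts by
  \<open>j < n - degree h\<close> already span the code.\<close>

lemma code_generated_by_in_subspace:
  fixes h :: "'a::field_gcd poly"
  assumes "n > 0" "h dvd constacyclic_modulus n lam" "poly_vs.subspace V"
    and "\<And>j. j < n - degree h \<Longrightarrow> monom 1 j * h \<in> V"
  shows "code_generated_by n lam h \<subseteq> V"
proof
  let ?m = "constacyclic_modulus n lam"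
  fix p assume "p \<in> code_generated_by n lam h"
  hence p: "degree p < n" "gcd h ?m dvd p"
    by (auto simp: code_generated_by_eq_dvd assms(1))
  have "h dvd p" by (rule dvd_trans[OF _ p(2)]) (use assms(2) in simp)
  then obtain u where u: "p = u * h" by (metis dvd_def mult.commute)
  show "p \<in> V"
  proof (cases "p = 0")
    case True
    thus ?thesis using assms(3) poly_vs.subspace_0 by blast
  next
    case False
    hence deg: "degree u + degree h < n"
      using p(1) u by (cases "u = 0 \<or> h = 0") (auto simp: degree_mult_eq)
    \<comment> \<open>Reduction modulo 0 is the identity.\<close>
    have "(u * h) mod 0 \<in> V"
      by (rule mult_mod_in_subspace[OF assms(3)]) (use deg assms(4) in auto)
    thus ?thesis using u by simp
  qed
qed

lemma monom_power_invertible: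
  assumes "n > 0" "lam \<noteq> 0"
  obtains u where "(monom 1 i * u) mod constacyclic_modulus n lam = 1 mod constacyclic_modulus n lam"
proof
  let ?m = "constacyclic_modulus n lam"
  \<comment> \<open>The inverse of \<open>x\<close> is \<open>x ^ (n - 1) / lam\<close>, because
    \<open>x ^ n / lam - 1\<close> is \<open>1 / lam\<close> times the modulus.\<close>
  let ?v = "monom (1 / lam) (n - 1)"
  have "monom 1 1 * ?v - 1 = smult (1 / lam) ?m"
    using assms by (simp add: mult_monom constacyclic_modulus_def smult_diff_right smult_monom one_pCons)
  hence "(monom 1 1 * ?v) mod ?m = 1 mod ?m"
    by (simp add: mod_eq_dvd_iff dvd_smult del: One_nat_def)
  hence "(monom 1 1 * ?v) ^ i mod ?m = 1 ^ i mod ?m"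
    by (metis power_mod)
  thus "(monom 1 i * ?v ^ i) mod ?m = 1 mod ?m"
    by (simp add: power_mult_distrib monom_power)
qed

text \<open>Multiplying \<open>c\<close> by the inverse of \<open>x ^ i\<close> stays inside the
  ideal and gives the preimage.\<close>

lemma shift_surj_code_generated_by:
  assumes "n > 0" "lam \<noteq> 0" "c \<in> code_generated_by n lam h"
  obtains d where "d \<in> code_generated_by n lam h"
    "c = (monom 1 i * d) mod constacyclic_modulus n lam"
proof -
  let ?m = "constacyclic_modulus n lam"
  obtain u where u: "(monom 1 i * u) mod ?m = 1 mod ?m"
    using monom_power_invertible[OF assms(1,2)] .
  obtain v where "c = (v * h) mod ?m"
    using assms code_generated_by_eq_multiples by blast
  hence c: "c mod ?m = c" by simp
  have "(monom 1 i * ((u * c) mod ?m)) mod ?m = (monom 1 i * u * c) mod ?m"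
    by (simp add: mod_mult_right_eq mult.assoc)
  also have "\<dots> = c"
    using u c by (metis mod_mult_left_eq mult_1)
  finally show thesis
    using that mult_mod_in_code_generated_by[OF assms(1,3)] by metis
qed

text \<open>Bezout, one element at a time. It serves for the ideal of all polynomials whose residue
  lies in a given code.\<close>

lemma Gcd_in_poly_ideal:
  fixes A J :: "'a::field_gcd poly set"
  assumes "finite A" "A \<subseteq> J" "0 \<in> J"
    and "\<And>x y. x \<in> J \<Longrightarrow> y \<in> J \<Longrightarrow> x + y \<in> J"
    and "\<And>r x. x \<in> J \<Longrightarrow> r * x \<in> J"
  shows "Gcd A \<in> J"
  using assms(1,2)
proof (induction A rule: finite_induct)
  case (insert a A)
  obtain u v where "u * a + v * Gcd A = gcd a (Gcd A)"
    using bezout_coefficients_fst_snd by blast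
  thus ?case using insert assms(4,5) by (metis Gcd_insert insert_subset)
qed (simp add: assms(3))

section \<open>The Schur product of two codes\<close>

lemma schur_in_schur_code:
  assumes "c \<in> C" "d \<in> D"
  shows "c \<circ>\<^sub>S d \<in> schur_code C D"
  unfolding schur_code_def using assms by (intro poly_vs.span_base) blast

text \<open>The polynomials whose shift lies in the product code form a subspace, so it is enough to
  shift a single product \<open>c \<circ>\<^sub>S d\<close>, and this shifts both factors.\<close>

lemma schur_code_shift:
  assumes n: "n > 0"
    and C: "\<And>c. c \<in> C \<Longrightarrow> degree c < n \<and> (monom 1 i * c) mod constacyclic_modulus n lam1 \<in> C"
    and D: "\<And>d. d \<in> D \<Longrightarrow> degree d < n \<and> (monom 1 i * d) mod constacyclic_modulus n lam2 \<in> D"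
    and p: "p \<in> schur_code C D"
  shows "(monom 1 i * p) mod constacyclic_modulus n (lam1 * lam2) \<in> schur_code C D"
proof -
  let ?m = "constacyclic_modulus n (lam1 * lam2)"
  have V: "poly_vs.subspace (schur_code C D)" unfolding schur_code_def by simp
  have "poly_vs.subspace {p. (monom 1 i * p) mod ?m \<in> schur_code C D}"
    by (rule poly_vs.subspaceI)
       (auto simp: distrib_left poly_mod_add_left mod_smult_left
         intro: poly_vs.subspace_0[OF V] poly_vs.subspace_add[OF V] poly_vs.subspace_scale[OF V])
  moreover have "(monom 1 i * (c \<circ>\<^sub>S d)) mod ?m \<in> schur_code C D" if "c \<in> C" "d \<in> D" for c d
    using C[OF that(1)] D[OF that(2)]
    by (simp add: schur_in_schur_code flip: schur_shift_iterated[OF n])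
  ultimately have "schur_code C D \<subseteq> {p. (monom 1 i * p) mod ?m \<in> schur_code C D}"
    by (subst (1) schur_code_def, intro poly_vs.span_minimal) auto
  thus ?thesis using p by blast
qed

theorem theorem14:
  fixes n q :: nat
    and lam1 lam2 :: "'a :: {field_gcd, finite}"
    and C1 C2 :: "'a poly set"
    and g1 g2 s :: "'a poly"
  assumes "card (UNIV :: 'a set) = q"
    and "n > 0"
    and "gcd n q = 1"
    and "lam1 \<noteq> 0" and "lam2 \<noteq> 0"
    and "constacyclic_code n lam1 C1" and "generator_polynomial n lam1 C1 g1"
    and "constacyclic_code n lam2 C2" and "generator_polynomial n lam2 C2 g2"
    and "gcd s (constacyclic_modulus n lam1 div g1) = 1"
  defines "g \<equiv> (g1 * s) mod constacyclic_modulus n lam1"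
  defines "P \<equiv> {g \<circ>\<^sub>S (monom 1 j * g2) | j. j < n - degree g2}"
  shows "constacyclic_code n (lam1 * lam2) (schur_code C1 C2) \<and>
         schur_code C1 C2 =
           code_generated_by n (lam1 * lam2) (Gcd (insert (constacyclic_modulus n (lam1 * lam2)) P))"
proof -
  note n = \<open>n > 0\<close>
  let ?m1 = "constacyclic_modulus n lam1"
  let ?m2 = "constacyclic_modulus n lam2"
  let ?m = "constacyclic_modulus n (lam1 * lam2)"
  define G where "G = Gcd (insert ?m P)"
  let ?E = "schur_code C1 C2"
  have g1: "g1 dvd ?m1" "C1 = code_generated_by n lam1 g1"
    and g2: "g2 dvd ?m2" "C2 = code_generated_by n lam2 g2"
    using assms(7,9) by (auto simp: generator_polynomial_def)
  have C1: "C1 = code_generated_by n lam1 g"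
    unfolding g1(2) g_def using code_generated_by_mult_coprime[OF n g1(1) assms(10)] by simp
  have deg: "degree c < n" if "c \<in> C1 \<union> C2" for c
    using that g1(2) g2(2) by (auto simp: code_generated_by_eq_dvd n)
  have deg_g: "degree g < n"
    by (simp add: g_def n degree_mod_constacyclic_modulus)
  have shift1: "(u * c) mod ?m1 \<in> C1" if "c \<in> C1" for u c
    using that mult_mod_in_code_generated_by[OF n] g1(2) by blast
  have shift2: "(u * c) mod ?m2 \<in> C2" if "c \<in> C2" for u c
    using that mult_mod_in_code_generated_by[OF n] g2(2) by blast
  have V: "poly_vs.subspace ?E" unfolding schur_code_def by simp
  \<comment> \<open>\<open>G\<close> divides the modulus and is already normalised.\<close>
  have gcd_G: "gcd G ?m = G"
    by (subst gcd_proj1_if_dvd) (auto simp: G_def simp del: Gcd_insert intro!: Gcd_dvd)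
  have code_G: "code_generated_by n (lam1 * lam2) G = {p. degree p < n \<and> G dvd p}"
    by (simp add: code_generated_by_eq_dvd n gcd_G)

  have ideal: "(u * p) mod ?m \<in> ?E" if "p \<in> ?E" for u p
    by (rule mult_mod_in_subspace[OF V], rule schur_code_shift[OF n _ _ that])
       (use deg shift1 shift2 in auto)
  have P_E: "P \<subseteq> ?E"
  proof
    fix p assume "p \<in> P"
    then obtain j where j: "p = g \<circ>\<^sub>S (monom 1 j * g2)" "j < n - degree g2"
      unfolding P_def by auto
    have "g \<in> C1"
      unfolding C1 code_generated_by_eq_dvd[OF n] using deg_g by simp
    \<comment> \<open>For these \<open>j\<close> the polynomial is its own representative, so it is
      a codeword without reduction.\<close>
    moreover have "degree (monom (1::'a) j * g2) < n"
      using degree_mult_le[of "monom (1::'a) j" g2] degree_monom_le[of "1::'a" j] j(2) by linarith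
    hence "monom 1 j * g2 \<in> C2"
      unfolding g2(2) code_generated_by_eq_dvd[OF n] by simp
    ultimately show "p \<in> ?E" unfolding j(1) by (rule schur_in_schur_code)
  qed
  \<comment> \<open>Residues in the product code define an ideal of the polynomial ring. It contains
    the modulus, with residue 0, and \<open>P\<close>, whose elements are their own
    residues.\<close>
  have "G \<in> {p. p mod ?m \<in> ?E}"
    unfolding G_def
  proof (rule Gcd_in_poly_ideal)
    show "finite (insert ?m P)" unfolding P_def by simp
    have "p mod ?m = p" if "p \<in> P" for p
      using that deg_g unfolding P_def
      by (auto intro!: mod_constacyclic_modulus_eq degree_schur_less)
    thus "insert ?m P \<subseteq> {p. p mod ?m \<in> ?E}"
      using P_E poly_vs.subspace_0[OF V] by auto
    show "r * x \<in> {p. p mod ?m \<in> ?E}" if "x \<in> {p. p mod ?m \<in> ?E}" for r x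
      using ideal[of "x mod ?m" r] that by (simp add: mod_mult_right_eq)
  qed (auto simp: poly_mod_add_left intro: poly_vs.subspace_0[OF V] poly_vs.subspace_add[OF V])
  hence "(u * G) mod ?m \<in> ?E" for u
    using ideal[of "G mod ?m" u] by (simp add: mod_mult_right_eq)
  hence sup: "code_generated_by n (lam1 * lam2) G \<subseteq> ?E"
    by (auto simp: code_generated_by_eq_multiples n)

  \<comment> \<open>With the first factor fixed at \<open>g\<close>, the condition is linear in
    \<open>d\<close>, and the spanning shifts of \<open>g2\<close> give exactly the elements of
    \<open>P\<close>.\<close>
  have g_dvd: "G dvd g \<circ>\<^sub>S d" if "d \<in> C2" for d
  proof -
    have "C2 \<subseteq> {d. G dvd g \<circ>\<^sub>S d}"
      unfolding g2(2)
    proof (rule code_generated_by_in_subspace[OF n g2(1)])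
      show "poly_vs.subspace {d. G dvd g \<circ>\<^sub>S d}"
        by (rule poly_vs.subspaceI)
           (auto simp: schur_0_right schur_add_right schur_smult_right dvd_smult)
      show "monom 1 j * g2 \<in> {d. G dvd g \<circ>\<^sub>S d}" if "j < n - degree g2" for j
        using that unfolding G_def P_def by (auto simp del: Gcd_insert intro!: Gcd_dvd)
    qed
    thus ?thesis using that by blast
  qed
  have dvd: "G dvd c \<circ>\<^sub>S d" if c: "c \<in> C1" and d: "d \<in> C2" for c d
  proof -
    obtain u where u: "c = (u * g) mod ?m1"
      using c unfolding C1 code_generated_by_eq_multiples[OF n] by blast
    have "(u * g) mod ?m1 \<in> {c. G dvd c \<circ>\<^sub>S d}"
    proof (rule mult_mod_in_subspace)
      show "poly_vs.subspace {c. G dvd c \<circ>\<^sub>S d}"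
        by (rule poly_vs.subspaceI)
           (auto simp: schur_0_left schur_add_left schur_smult_left dvd_smult)
      \<comment> \<open>Now \<open>d\<close> is fixed and \<open>c\<close> is split into shifts of
        \<open>g\<close>. The vector \<open>d'\<close> depends on \<open>i\<close>: it undoes the
        shift on \<open>d\<close>, so that both factors are shifted equally.\<close>
      fix i
      obtain d' where d': "d' \<in> C2" "d = (monom 1 i * d') mod ?m2"
        using shift_surj_code_generated_by[OF n \<open>lam2 \<noteq> 0\<close>] d g2(2) by metis
      have "((monom 1 i * g) mod ?m1) \<circ>\<^sub>S d = (monom 1 i * (g \<circ>\<^sub>S d')) mod ?m"
        unfolding d'(2) using deg[of d'] d'(1) deg_g by (intro schur_shift_iterated n) auto
      \<comment> \<open>Hence reduction modulo \<open>?m\<close> preserves divisibility by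
        \<open>G\<close>.\<close>
      moreover have "G dvd ?m" by (simp add: G_def)
      ultimately show "(monom 1 i * g) mod ?m1 \<in> {c. G dvd c \<circ>\<^sub>S d}"
        using g_dvd[OF d'(1)] by (simp add: dvd_mod)
    qed
    thus ?thesis using u by simp
  qed
  have "?E \<subseteq> {p. degree p < n \<and> G dvd p}"
    unfolding schur_code_def
  proof (rule poly_vs.span_minimal)
    show "{c \<circ>\<^sub>S d |c d. c \<in> C1 \<and> d \<in> C2} \<subseteq> {p. degree p < n \<and> G dvd p}"
      using dvd deg by (auto intro!: degree_schur_less)
    show "poly_vs.subspace {p. degree p < n \<and> G dvd p}"
      by (rule poly_vs.subspaceI)
         (use n in \<open>auto simp: degree_add_less dvd_smult\<close>)
  qed
  with sup have "?E = code_generated_by n (lam1 * lam2) G"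
    unfolding code_G by blast
  thus ?thesis
    using constacyclic_code_generated_by[OF n] unfolding G_def by metis
qed

end
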